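(* Let $k\geq 3$. Every monotone-forcing subset of $S_k$ contains $B_k$.
   Context: $S_k$ is the set of permutations of $\{1,\dots,k\}$ in one-line notation; $\operatorname{id}_n=12\cdots n$ and $\operatorname{id}_n^r=n\cdots 21$. For $\pi$, the complement is $\pi^c(i)=n+1-\pi(i)$. Pattern containment/avoidance is classical: $\pi$ contains $p\in S_k$ if some subsequence of $\pi$ of length $k$ is order-isomorphic to $p$. For $X\subseteq S_k$, $\operatorname{Av}_n(X)$ is the set of $\pi\in S_n$ avoiding every pattern in $X$. For $k\geq 3$ define $p_k=12\cdots(k-2)\,k\,(k-1)$, $q_k=1\,k\,(k-1)\cdots 2$, $r_k=2\,1\,3\,4\cdots k$, $s_k=2\,3\cdots k\,1$, and $B_k=\{p_k,q_k,r_k,s_k,p_k^c,q_k^c,r_k^c,s_k^c\}$. A set $X\subseteq S_k$ is monotone forcing if there exists $N$ such that $\operatorname{Av}_n(X)=\{\operatorname{id}_n,\operatorname{id}_n^r\}$ for all $n\geq N$. *)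

theory Defs
  imports Main "HOL-Library.Sublist" "HOL-Combinatorics.Multiset_Permutations"
begin

(* Permutations of {1,...,n} are given in one-line notation, as lists of naturals;
   the entry \<pi>(i) is the list element at position i - 1. *)

definition Sym :: "nat \<Rightarrow> nat list set" where
  "Sym n = permutations_of_set {1..n}"

definition id_perm :: "nat \<Rightarrow> nat list" where
  "id_perm n = [1..<n+1]"

definition complement :: "nat list \<Rightarrow> nat list" where
  "complement \<pi> = map (\<lambda>x. length \<pi> + 1 - x) \<pi>"

definition order_isomorphic :: "nat list \<Rightarrow> nat list \<Rightarrow> bool" where
  "order_isomorphic xs ys \<longleftrightarrow>
     length xs = length ys \<and>
     (\<forall>i<length xs. \<forall>j<length xs. xs ! i < xs ! j \<longleftrightarrow> ys ! i < ys ! j)"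

(* subseq is the library's relation "(not necessarily contiguous) subsequence" on lists *)
definition contains :: "nat list \<Rightarrow> nat list \<Rightarrow> bool" where
  "contains \<pi> p \<longleftrightarrow> (\<exists>\<sigma>. subseq \<sigma> \<pi> \<and> order_isomorphic \<sigma> p)"

definition Av :: "nat \<Rightarrow> nat list set \<Rightarrow> nat list set" where
  "Av n X = {\<pi> \<in> Sym n. \<forall>p\<in>X. \<not> contains \<pi> p}"

(* p_perm, q_perm, r_perm and s_perm are only meant for k \<ge> 3, where each of them is in Sym k. *)

definition p_perm :: "nat \<Rightarrow> nat list" where
  "p_perm k = [1..<k-1] @ [k, k - 1]"

definition q_perm :: "nat \<Rightarrow> nat list" where
  "q_perm k = 1 # rev [2..<k+1]"

definition r_perm :: "nat \<Rightarrow> nat list" where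
  "r_perm k = [2, 1] @ [3..<k+1]"

definition s_perm :: "nat \<Rightarrow> nat list" where
  "s_perm k = [2..<k+1] @ [1]"

definition B :: "nat \<Rightarrow> nat list set" where
  "B k = {p_perm k, q_perm k, r_perm k, s_perm k,
          complement (p_perm k), complement (q_perm k),
          complement (r_perm k), complement (s_perm k)}"

definition monotone_forcing :: "nat \<Rightarrow> nat list set \<Rightarrow> bool" where
  "monotone_forcing k X \<longleftrightarrow>
     X \<subseteq> Sym k \<and> (\<exists>N. \<forall>n\<ge>N. Av n X = {id_perm n, rev (id_perm n)})"

end

theory Submission
  imports Defs
begin

text \<open>For large \<^term>\<open>n\<close> the permutation \<^term>\<open>p_perm n\<close> is not monotone, so it contains a
  member of \<^term>\<open>X\<close>. Its only patterns of length \<^term>\<open>k\<close> are the identity and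
  \<^term>\<open>p_perm k\<close>, and a monotone pattern cannot lie in \<^term>\<open>X\<close>; hence
  \<^term>\<open>p_perm k \<in> X\<close>. The same argument works for \<^term>\<open>q_perm k\<close>. Reversal and complement
  preserve monotone forcing, and the orbits of these two patterns make up \<^term>\<open>B k\<close>.\<close>

section \<open>Permutations as lists and the uniqueness of a pattern\<close>

lemma Sym_iff: "xs \<in> Sym n \<longleftrightarrow> distinct xs \<and> set xs = {1..n}"
  by (auto simp: Sym_def permutations_of_set_def)

lemma length_Sym: "xs \<in> Sym n \<Longrightarrow> length xs = n"
  by (metis Sym_iff card_atLeastAtMost diff_Suc_1 distinct_card)

lemma nth_Sym: "xs \<in> Sym n \<Longrightarrow> i < n \<Longrightarrow> 1 \<le> xs ! i \<and> xs ! i \<le> n"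
  by (metis Sym_iff atLeastAtMost_iff length_Sym nth_mem)

text \<open>The values below an entry are exactly the smaller positive integers, each at one
  position. So comparisons alone determine the entry.\<close>

lemma Sym_nth_eq_card:
  assumes "xs \<in> Sym n" and "i < n"
  shows "xs ! i = Suc (card {j. j < n \<and> xs ! j < xs ! i})"
proof -
  have len: "length xs = n" and dist: "distinct xs" and set: "set xs = {1..n}"
    using assms length_Sym Sym_iff by auto
  have "(!) xs ` {j. j < n \<and> xs ! j < xs ! i} = {1..<xs ! i}"
  proof (intro equalityI subsetI)
    fix y assume y: "y \<in> {1..<xs ! i}"
    then have "y \<in> set xs"
      using nth_Sym[OF assms] by (auto simp: set)
    then show "y \<in> (!) xs ` {j. j < n \<and> xs ! j < xs ! i}"
      using y len by (auto simp: in_set_conv_nth)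
  qed (use nth_Sym[OF assms(1)] in auto)
  moreover have "inj_on ((!) xs) {j. j < n \<and> xs ! j < xs ! i}"
    using dist len by (auto simp: inj_on_def nth_eq_iff_index_eq)
  ultimately have "card {j. j < n \<and> xs ! j < xs ! i} = card {1..<xs ! i}"
    by (metis card_image)
  then show ?thesis
    using nth_Sym[OF assms] by simp
qed

lemma order_isomorphic_Sym_unique:
  assumes "order_isomorphic \<sigma> \<tau>" and "order_isomorphic \<sigma> p" and "\<tau> \<in> Sym k" and "p \<in> Sym k"
  shows "p = \<tau>"
proof (rule nth_equalityI)
  show "length p = length \<tau>"
    using assms length_Sym by metis
  fix i assume "i < length p"
  then have i: "i < k"
    using assms length_Sym by metis
  have "\<tau> ! i' < \<tau> ! j \<longleftrightarrow> p ! i' < p ! j" if "i' < k" "j < k" for i' j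
    using assms(1,2) that length_Sym[OF assms(3)] by (auto simp: order_isomorphic_def)
  then have "{j. j < k \<and> p ! j < p ! i} = {j. j < k \<and> \<tau> ! j < \<tau> ! i}"
    using i by auto
  then show "p ! i = \<tau> ! i"
    using Sym_nth_eq_card[OF assms(3) i] Sym_nth_eq_card[OF assms(4) i] by simp
qed

text \<open>Replacing the value \<open>x\<close> by the \<open>x\<close>-th smallest element of
  \<open>w\<close> preserves comparisons because \<open>w\<close> is strictly increasing.\<close>

lemma order_isomorphic_map_nth:
  assumes "sorted_wrt (<) w" and "\<tau> \<in> Sym (length w)"
  shows "order_isomorphic (map (\<lambda>x. w ! (x - 1)) \<tau>) \<tau>"
proof -
  have "w ! (x - 1) < w ! (y - 1) \<longleftrightarrow> x < y"
    if "1 \<le> x" "x \<le> length w" "1 \<le> y" "y \<le> length w" for x y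
    using that sorted_wrt_nth_less[OF assms(1), of "x - 1" "y - 1"]
      sorted_wrt_nth_less[OF assms(1), of "y - 1" "x - 1"]
    by (cases x y rule: linorder_cases) fastforce+
  then show ?thesis
    using nth_Sym[OF assms(2)] length_Sym[OF assms(2)] by (auto simp: order_isomorphic_def)
qed

text \<open>Used to read off the pattern of a subsequence: sort its values into \<open>w\<close>,
  then write the subsequence as \<open>w\<close> arranged according to
  \<open>\<tau>\<close>.\<close>

lemma pattern_eq_of_map_nth:
  assumes "order_isomorphic (map (\<lambda>x. w ! (x - 1)) \<tau>) p" and "sorted_wrt (<) w"
    and "\<tau> \<in> Sym (length w)" and "p \<in> Sym (length w)"
  shows "p = \<tau>"
  using assms order_isomorphic_map_nth order_isomorphic_Sym_unique by blast

text \<open>Values count from 1 and list positions from 0; with this shift a run of consecutive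
  values selects a contiguous slice of \<open>w\<close>.\<close>

lemma map_nth_pred_upt:
  "b \<le> length w \<Longrightarrow> map (\<lambda>x. w ! (x - 1)) [Suc a..<Suc b] = drop a (take b w)"
  by (rule nth_equalityI) (auto simp del: upt_Suc)

section \<open>The special permutations and the patterns of monotone lists\<close>

lemma id_perm_in_Sym: "id_perm n \<in> Sym n"
  by (auto simp: Sym_iff id_perm_def)

lemma rev_in_Sym_iff [simp]: "rev p \<in> Sym n \<longleftrightarrow> p \<in> Sym n"
  by (simp add: Sym_iff)

lemma p_perm_in_Sym: "k \<ge> 3 \<Longrightarrow> p_perm k \<in> Sym k"
  by (auto simp: Sym_iff p_perm_def)

lemma q_perm_in_Sym: "k \<ge> 3 \<Longrightarrow> q_perm k \<in> Sym k"
  by (auto simp: Sym_iff q_perm_def)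

lemma pattern_of_increasing:
  assumes "sorted_wrt (<) \<sigma>" and "order_isomorphic \<sigma> p" and "p \<in> Sym k"
  shows "p = id_perm k"
proof -
  have len: "length \<sigma> = k"
    using assms length_Sym by (auto simp: order_isomorphic_def)
  have "map (\<lambda>x. \<sigma> ! (x - 1)) (id_perm k) = \<sigma>"
    using map_nth_pred_upt[of k \<sigma> 0] len by (simp add: id_perm_def)
  then show ?thesis
    using pattern_eq_of_map_nth[of \<sigma> "id_perm k" p] assms len id_perm_in_Sym by simp
qed

lemma pattern_of_decreasing:
  assumes "sorted_wrt (>) \<sigma>" and "order_isomorphic \<sigma> p" and "p \<in> Sym k"
  shows "p = rev (id_perm k)"
proof -
  have len: "length \<sigma> = k"
    using assms length_Sym by (auto simp: order_isomorphic_def)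
  \<comment> \<open>The sorted list of values is now \<open>rev \<sigma>\<close>.\<close>
  have "map (\<lambda>x. rev \<sigma> ! (x - 1)) (rev (id_perm k)) = \<sigma>"
    using map_nth_pred_upt[of k "rev \<sigma>" 0] len by (simp add: id_perm_def rev_map[symmetric])
  then show ?thesis
    using pattern_eq_of_map_nth[of "rev \<sigma>" "rev (id_perm k)" p] assms len id_perm_in_Sym
    by (simp add: sorted_wrt_rev)
qed

section \<open>Patterns contained in \<open>p_perm n\<close> and \<open>q_perm n\<close>\<close>

lemma subseq_set_subset: "subseq xs ys \<Longrightarrow> set xs \<subseteq> set ys"
  by (induction rule: list_emb.induct) auto

lemma sorted_wrt_subseq: "subseq xs ys \<Longrightarrow> sorted_wrt P ys \<Longrightarrow> sorted_wrt P xs"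
  by (induction rule: list_emb.induct) (auto dest: subseq_set_subset)

text \<open>The only descent of \<open>p_perm n\<close> is its final pair. A subsequence keeping
  both entries of the pair has the shape of \<open>p_perm k\<close>; any other is
  increasing.\<close>

lemma patterns_of_p_perm:
  assumes "contains (p_perm n) p" and "p \<in> Sym k" and "k \<ge> 3" and "n \<ge> 3"
  shows "p \<in> {id_perm k, p_perm k}"
proof -
  obtain \<sigma> where sub: "subseq \<sigma> (p_perm n)" and iso: "order_isomorphic \<sigma> p"
    using assms(1) by (auto simp: contains_def)
  have len: "length \<sigma> = k"
    using iso assms(2) length_Sym by (auto simp: order_isomorphic_def)
  obtain \<sigma>\<^sub>1 \<sigma>\<^sub>2 where \<sigma>: "\<sigma> = \<sigma>\<^sub>1 @ \<sigma>\<^sub>2"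
    and sub1: "subseq \<sigma>\<^sub>1 [1..<n - 1]" and sub2: "subseq \<sigma>\<^sub>2 [n, n - 1]"
    using sub unfolding p_perm_def by (auto elim: subseq_appendE)
  have sorted: "sorted_wrt (<) \<sigma>\<^sub>1"
    by (rule sorted_wrt_subseq[OF sub1]) simp
  have small: "x < n - 1" if "x \<in> set \<sigma>\<^sub>1" for x
    using subseq_set_subset[OF sub1] that by auto
  have "\<sigma>\<^sub>2 \<in> {[], [n], [n - 1], [n, n - 1]}"
    using sub2 by (auto simp flip: in_set_subseqs)
  then consider "\<sigma>\<^sub>2 = [n, n - 1]" | "sorted_wrt (<) \<sigma>"
    using sorted small unfolding \<sigma> by (fastforce simp: sorted_wrt_append)
  then show ?thesis
  proof cases
    case 1
    \<comment> \<open>The values of \<open>\<sigma>\<close> in increasing order: only the final pair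
      has to be swapped.\<close>
    let ?w = "\<sigma>\<^sub>1 @ [n - 1, n]"
    have l1: "k = length \<sigma>\<^sub>1 + 2"
      using len 1 \<sigma> by simp
    have "map (\<lambda>x. ?w ! (x - 1)) (p_perm k) = \<sigma>"
      using map_nth_pred_upt[of "length \<sigma>\<^sub>1" ?w 0] 1 by (simp add: p_perm_def l1 \<sigma> nth_append)
    moreover have "sorted_wrt (<) ?w"
      using sorted small assms(4) by (fastforce simp: sorted_wrt_append)
    ultimately show ?thesis
      using pattern_eq_of_map_nth[of ?w "p_perm k" p] iso assms p_perm_in_Sym l1 by simp
  qed (use pattern_of_increasing iso assms in blast)
qed

text \<open>After its leading 1, \<open>q_perm n\<close> is decreasing, so everything depends on
  whether the subsequence keeps that 1.\<close>

lemma patterns_of_q_perm: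
  assumes "contains (q_perm n) p" and "p \<in> Sym k" and "k \<ge> 3"
  shows "p \<in> {rev (id_perm k), q_perm k}"
proof -
  obtain \<sigma> where sub: "subseq \<sigma> (q_perm n)" and iso: "order_isomorphic \<sigma> p"
    using assms(1) by (auto simp: contains_def)
  have len: "length \<sigma> = k"
    using iso assms(2) length_Sym by (auto simp: order_isomorphic_def)
  have dec: "sorted_wrt (>) \<sigma>'" if "subseq \<sigma>' (rev [2..<n + 1])" for \<sigma>'
    by (rule sorted_wrt_subseq[OF that]) (simp add: sorted_wrt_rev del: upt_Suc)
  consider \<sigma>' where "\<sigma> = 1 # \<sigma>'" "subseq \<sigma>' (rev [2..<n + 1])" | "subseq \<sigma> (rev [2..<n + 1])"
    using sub unfolding q_perm_def by (cases \<sigma>) (auto split: if_splits)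
  then show ?thesis
  proof cases
    case (1 \<sigma>')
    let ?w = "1 # rev \<sigma>'"
    have l1: "k = length \<sigma>' + 1"
      using len 1 by simp
    have "map (\<lambda>x. ?w ! (x - 1)) (q_perm k) = \<sigma>"
      using map_nth_pred_upt[of k ?w 1] 1 l1
      by (simp add: q_perm_def rev_map[symmetric] numeral_2_eq_2)
    moreover have "1 < x" if "x \<in> set \<sigma>'" for x
      using subseq_set_subset[OF 1(2)] that by auto
    then have "sorted_wrt (<) ?w"
      using dec[OF 1(2)] by (auto simp: sorted_wrt_rev)
    ultimately show ?thesis
      using pattern_eq_of_map_nth[of ?w "q_perm k" p] iso assms q_perm_in_Sym l1 by simp
  qed (use pattern_of_decreasing iso assms dec in blast)
qed

lemma id_perm_contains: "k \<le> n \<Longrightarrow> contains (id_perm n) (id_perm k)"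
proof -
  assume "k \<le> n"
  then have "id_perm n = id_perm k @ [k + 1..<n + 1]"
    unfolding id_perm_def using upt_add_eq_append[of 1 "k + 1" "n - k"] by simp
  then have "subseq (id_perm k) (id_perm n)"
    by (simp add: subseq_rev_drop_many del: upt_Suc)
  then show ?thesis
    by (auto simp: contains_def order_isomorphic_def)
qed

section \<open>Reversal and complement as symmetries of containment and of monotone forcing\<close>

lemma order_isomorphic_rev: "order_isomorphic \<sigma> p \<Longrightarrow> order_isomorphic (rev \<sigma>) (rev p)"
  by (auto simp: order_isomorphic_def rev_nth)

lemma subseq_rev: "subseq xs ys \<Longrightarrow> subseq (rev xs) (rev ys)"
  by (induction rule: list_emb.induct) (auto intro: subseq_rev_drop_many list_emb_append_mono)

lemma contains_rev: "contains \<pi> p \<Longrightarrow> contains (rev \<pi>) (rev p)"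
  by (metis contains_def order_isomorphic_rev subseq_rev)

lemma complement_in_Sym:
  assumes "\<pi> \<in> Sym n"
  shows "complement \<pi> \<in> Sym n"
proof -
  have "(\<lambda>x. n + 1 - x) ` {1..n} = {1..n}"
  proof (intro equalityI subsetI)
    fix y assume "y \<in> {1..n}"
    then have "y = n + 1 - (n + 1 - y)" "n + 1 - y \<in> {1..n}"
      by auto
    then show "y \<in> (\<lambda>x. n + 1 - x) ` {1..n}"
      by blast
  qed auto
  moreover have "inj_on (\<lambda>x. n + 1 - x) {1..n}"
    by (auto simp: inj_on_def)
  ultimately show ?thesis
    using assms length_Sym[OF assms] by (auto simp: Sym_iff complement_def distinct_map)
qed

lemma complement_complement:
  assumes "\<pi> \<in> Sym n"
  shows "complement (complement \<pi>) = \<pi>"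
  using nth_Sym[OF assms] length_Sym[OF assms]
  by (intro nth_equalityI) (auto simp: complement_def Suc_diff_le)

lemma complement_rev: "complement (rev \<pi>) = rev (complement \<pi>)"
  by (simp add: complement_def rev_map)

lemma complement_id_perm: "complement (id_perm n) = rev (id_perm n)"
  by (rule nth_equalityI) (auto simp: complement_def id_perm_def rev_nth simp del: upt_Suc)

lemma contains_complement:
  assumes "contains \<pi> p" and "\<pi> \<in> Sym n" and "p \<in> Sym k"
  shows "contains (complement \<pi>) (complement p)"
proof -
  obtain \<sigma> where sub: "subseq \<sigma> \<pi>" and iso: "order_isomorphic \<sigma> p"
    using assms(1) by (auto simp: contains_def)
  \<comment> \<open>The entries are reflected relative to the length of \<open>\<pi>\<close>, not of
    \<open>\<sigma>\<close>, so that the result is a subsequence of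
    \<open>complement \<pi>\<close>.\<close>
  let ?\<sigma> = "map (\<lambda>x. length \<pi> + 1 - x) \<sigma>"
  \<comment> \<open>These bounds keep the natural-number subtractions from truncating, so both
    reflections reverse comparisons.\<close>
  have "\<sigma> ! i \<le> n" if "i < length \<sigma>" for i
    using subseq_set_subset[OF sub] nth_mem[OF that] assms(2) by (auto simp: Sym_iff)
  moreover have "p ! i \<le> k" if "i < length \<sigma>" for i
    using that iso nth_Sym[OF assms(3)] length_Sym[OF assms(3)] by (auto simp: order_isomorphic_def)
  ultimately have "order_isomorphic ?\<sigma> (complement p)"
    using iso length_Sym[OF assms(2)] length_Sym[OF assms(3)]
    by (fastforce simp: order_isomorphic_def complement_def Suc_diff_le)
  moreover have "subseq ?\<sigma> (complement \<pi>)"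
    using sub by (simp add: complement_def subseq_map)
  ultimately show ?thesis
    by (auto simp: contains_def)
qed

text \<open>An involution that preserves containment carries avoiders of \<open>X\<close> to
  avoiders of its image. It swaps the two monotone permutations, so the pair of them is
  unchanged.\<close>

lemma monotone_forcing_image:
  assumes forcing: "monotone_forcing k X"
    and Sym: "\<And>n \<pi>. \<pi> \<in> Sym n \<Longrightarrow> f \<pi> \<in> Sym n"
    and invol: "\<And>n \<pi>. \<pi> \<in> Sym n \<Longrightarrow> f (f \<pi>) = \<pi>"
    and cont: "\<And>n \<pi> p. contains \<pi> p \<Longrightarrow> \<pi> \<in> Sym n \<Longrightarrow> p \<in> Sym k \<Longrightarrow> contains (f \<pi>) (f p)"
    and id: "\<And>n. f (id_perm n) = rev (id_perm n)"
  shows "monotone_forcing k (f ` X)"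
proof -
  obtain N where X: "X \<subseteq> Sym k" and N: "\<forall>n\<ge>N. Av n X = {id_perm n, rev (id_perm n)}"
    using forcing by (auto simp: monotone_forcing_def)
  have id': "f (rev (id_perm n)) = id_perm n" for n
    using id invol[OF id_perm_in_Sym] by metis
  have "Av n (f ` X) = f ` Av n X" for n
  proof (intro equalityI subsetI)
    fix \<pi> assume \<pi>: "\<pi> \<in> Av n (f ` X)"
    then have "\<pi> \<in> Sym n"
      by (simp add: Av_def)
    moreover have "\<not> contains (f \<pi>) p" if "p \<in> X" for p
      using \<pi> that X cont[of "f \<pi>" p n] Sym invol by (auto simp: Av_def)
    ultimately have "f \<pi> \<in> Av n X"
      using Sym by (auto simp: Av_def)
    then show "\<pi> \<in> f ` Av n X"
      using invol[OF \<open>\<pi> \<in> Sym n\<close>] by (metis imageI)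
  next
    fix \<pi> assume "\<pi> \<in> f ` Av n X"
    then obtain \<rho> where \<rho>: "\<rho> \<in> Av n X" "\<pi> = f \<rho>"
      by blast
    then have "\<rho> \<in> Sym n"
      by (simp add: Av_def)
    moreover have "\<not> contains \<pi> (f p)" if "p \<in> X" for p
      using \<rho> that X cont[of \<pi> "f p" n] Sym[OF \<open>\<rho> \<in> Sym n\<close>] Sym[of p k]
        invol[OF \<open>\<rho> \<in> Sym n\<close>] invol[of p k]
      by (auto simp: Av_def)
    ultimately show "\<pi> \<in> Av n (f ` X)"
      using \<rho> Sym by (auto simp: Av_def)
  qed
  then have "\<forall>n\<ge>N. Av n (f ` X) = {id_perm n, rev (id_perm n)}"
    using N id id' by auto
  then show ?thesis
    using X Sym by (auto simp: monotone_forcing_def)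
qed

lemma monotone_forcing_rev: "monotone_forcing k X \<Longrightarrow> monotone_forcing k (rev ` X)"
  by (erule monotone_forcing_image) (auto intro: contains_rev)

lemma monotone_forcing_complement:
  "monotone_forcing k X \<Longrightarrow> monotone_forcing k (complement ` X)"
  by (erule monotone_forcing_image)
    (auto simp: complement_in_Sym complement_complement contains_complement complement_id_perm)

section \<open>Forcing \<open>p_perm k\<close> and \<open>q_perm k\<close>\<close>

lemma forced_pattern:
  assumes forcing: "monotone_forcing k X"
    and family: "\<And>n. n \<ge> 3 \<Longrightarrow> \<pi> n \<in> Sym n - {id_perm n, rev (id_perm n)}"
    and patterns: "\<And>n p. n \<ge> 3 \<Longrightarrow> contains (\<pi> n) p \<Longrightarrow> p \<in> Sym k \<Longrightarrow>
      p \<in> {id_perm k, rev (id_perm k), b}"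
  shows "b \<in> X"
proof -
  obtain N where X: "X \<subseteq> Sym k" and N: "\<forall>n\<ge>N. Av n X = {id_perm n, rev (id_perm n)}"
    using forcing by (auto simp: monotone_forcing_def)
  \<comment> \<open>Large enough for forcing to apply, for \<open>id_perm n\<close> to contain
    \<open>id_perm k\<close>, and for the family to be defined.\<close>
  define n where "n = N + k + 3"
  have Av: "Av n X = {id_perm n, rev (id_perm n)}"
    using N by (simp add: n_def)
  have cont: "contains (id_perm n) (id_perm k)"
    by (simp add: id_perm_contains n_def)
  \<comment> \<open>Both monotone permutations of length \<open>n\<close> avoid \<open>X\<close>,
    yet they contain those of length \<open>k\<close>.\<close>
  have "id_perm k \<notin> X"
    using Av cont by (auto simp: Av_def)
  moreover have "rev (id_perm k) \<notin> X"
    using Av contains_rev[OF cont] unfolding Av_def by blast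
  moreover have "\<pi> n \<in> Sym n - Av n X"
    using family[of n] Av by (simp add: n_def)
  then obtain p where "p \<in> X" "contains (\<pi> n) p"
    by (auto simp: Av_def)
  ultimately show ?thesis
    using patterns[of n p] X by (auto simp: n_def)
qed

lemma p_perm_forced:
  assumes "k \<ge> 3" and "monotone_forcing k X"
  shows "p_perm k \<in> X"
proof (rule forced_pattern[OF assms(2)])
  fix n :: nat assume n: "n \<ge> 3"
  \<comment> \<open>The first entry is 1 rather than \<open>n\<close>, and the last is
    \<open>n - 1\<close> rather than \<open>n\<close>.\<close>
  have "hd (p_perm n) \<noteq> hd (rev (id_perm n))" "last (p_perm n) \<noteq> last (id_perm n)"
    using n by (auto simp: p_perm_def id_perm_def hd_append)
  then show "p_perm n \<in> Sym n - {id_perm n, rev (id_perm n)}"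
    using p_perm_in_Sym[OF n] by auto
  show "p \<in> {id_perm k, rev (id_perm k), p_perm k}"
    if "contains (p_perm n) p" and "p \<in> Sym k" for p
    using patterns_of_p_perm[OF that assms(1) n] by blast
qed

lemma q_perm_forced:
  assumes "k \<ge> 3" and "monotone_forcing k X"
  shows "q_perm k \<in> X"
proof (rule forced_pattern[OF assms(2)])
  fix n :: nat assume n: "n \<ge> 3"
  have "hd (q_perm n) \<noteq> hd (rev (id_perm n))" "last (q_perm n) \<noteq> last (id_perm n)"
    using n by (auto simp: q_perm_def id_perm_def last_rev)
  then show "q_perm n \<in> Sym n - {id_perm n, rev (id_perm n)}"
    using q_perm_in_Sym[OF n] by auto
  show "p \<in> {id_perm k, rev (id_perm k), q_perm k}"
    if "contains (q_perm n) p" and "p \<in> Sym k" for p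
    using patterns_of_q_perm[OF that assms(1)] by blast
qed

section \<open>The remaining members of \<open>B k\<close> by symmetry\<close>

lemma s_perm_eq: "s_perm k = rev (q_perm k)"
  by (simp add: s_perm_def q_perm_def)

lemma r_perm_eq:
  assumes "k \<ge> 3"
  shows "r_perm k = complement (rev (p_perm k))"
proof -
  have len: "length (p_perm k) = k"
    using length_Sym p_perm_in_Sym assms by blast
  \<comment> \<open>Reflection turns the reversed initial run into 3, ..., \<open>k\<close>; the
    pair \<open>k - 1\<close>, \<open>k\<close> becomes 2, 1.\<close>
  have upt: "map (\<lambda>x. k + 1 - x) (rev [1..<k - 1]) = [3..<k + 1]"
    using assms by (intro nth_equalityI) (auto simp: rev_nth simp del: upt_Suc)
  have "complement (rev (p_perm k)) = map (\<lambda>x. k + 1 - x) ([k - 1, k] @ rev [1..<k - 1])"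
    by (simp only: complement_def length_rev len) (simp add: p_perm_def)
  also have "\<dots> = r_perm k"
    unfolding map_append upt using assms by (simp add: r_perm_def)
  finally show ?thesis ..
qed

theorem theorem4p3:
  fixes k :: nat and X :: "nat list set"
  assumes "k \<ge> 3"
    and "monotone_forcing k X"
  shows "B k \<subseteq> X"
proof -
  have complement_mem: "complement p \<in> Y"
    if "monotone_forcing k Y" and "p \<in> complement ` Y" for p Y
    using that by (auto simp: monotone_forcing_def complement_complement)
  have pq: "{p_perm k, q_perm k} \<subseteq> Y" if "monotone_forcing k Y" for Y
    using that p_perm_forced q_perm_forced assms(1) by blast
  have pqc: "complement ` {p_perm k, q_perm k} \<subseteq> Y" if "monotone_forcing k Y" for Y
    using complement_mem[OF that] pq[OF monotone_forcing_complement[OF that]] by blast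
  have "{rev (p_perm k), rev (q_perm k)} \<subseteq> X"
    using pq[OF monotone_forcing_rev[OF assms(2)]] by auto
  moreover have "{rev (complement (p_perm k)), rev (complement (q_perm k))} \<subseteq> X"
    using pqc[OF monotone_forcing_rev[OF assms(2)]] by auto
  moreover have "complement (r_perm k) = rev (p_perm k)"
    using complement_complement p_perm_in_Sym assms(1) by (metis r_perm_eq rev_in_Sym_iff)
  ultimately show ?thesis
    using pq[OF assms(2)] pqc[OF assms(2)]
    by (simp add: B_def s_perm_eq r_perm_eq[OF assms(1)] complement_rev)
qed

end
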